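(* Let $n\ge 1$. Let $\mathcal{M}_n$ be the set of Motzkin paths of length $n$ and let $\mathcal{W}_3(n)$ be the set of Yamanouchi words of length $n$ on the alphabet $\{1,2,3\}$. The step-labeling procedure described in the context, which assigns to each $\pi\in\mathcal{M}_n$ a word $\phi(\pi)$ of length $n$, defines a bijection $\phi:\mathcal{M}_n\to\mathcal{W}_3(n)$.
   Context: A Motzkin path of length $n$ is a lattice path from $(0,0)$ to $(n,0)$ using up steps $(1,1)$, down steps $(1,-1)$ and level steps $(1,0)$ that never goes below the $x$-axis. Given a standard Young tableau $T$ with $n$ entries, its Yamanouchi word $\chi(T)$ is the word of length $n$ whose $j$th letter is the index of the row of $T$ containing the number $j$. Then $\mathcal{W}_3(n)=\{\chi(T)\}$ where $T$ ranges over the standard Young tableaux with $n$ entries and at most three rows. Equivalently, $\mathcal{W}_3(n)$ is the set of words of length $n$ on $\{1,2,3\}$ such that in every prefix the number of 1's is at least the number of 2's, which is at least the number of 3's. The map $\phi$: write $\pi=x_1x_2\cdots x_n$, where $x_i$ is the $i$th step of $\pi$. Label the steps of $\pi$ by the following procedure. (A1) If the current path starts with a level step, label this first step by $1$. Otherwise the current path starts with an up step. Let $x_j$ be the first step of the current path that is not an up step, and let $x_{j-1}$ denote the step immediately preceding it in the current path. There are two cases. If $x_j$ is a down step, label the two steps $x_{j-1}$ and $x_j$ by $1$ and $2$, respectively. If $x_j$ is a level step, let $x_k$ be the first down step of the current path after $x_j$, and label the three steps $x_{j-1}$, $x_j$, $x_k$ by $1$, $2$, $3$, respectively. (A2) Form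 a new current path by removing the steps just labeled and concatenating the remaining segments of steps. If it is empty, stop; otherwise return to (A1) with the new path. When the procedure stops every step of the original path has received a label, and $\phi(\pi)$ is the word obtained by reading the labels of $x_1,x_2,\dots,x_n$ in order. *)

theory Defs
  imports Main "HOL-Library.While_Combinator"
begin

section \<open>Motzkin paths\<close>

datatype step = Up | Level | Down

fun rise :: "step \<Rightarrow> int" where
  "rise Up = 1"
| "rise Level = 0"
| "rise Down = -1"

definition height :: "step list \<Rightarrow> nat \<Rightarrow> int" where
  "height p k = sum_list (map rise (take k p))"

definition motzkin_paths :: "nat \<Rightarrow> step list set" where
  "motzkin_paths n = {p. length p = n \<and> (\<forall>k\<le>n. 0 \<le> height p k) \<and> height p n = 0}"


section \<open>Standard Young tableaux and Yamanouchi words\<close>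

text \<open>A tableau is the list of its (nonempty) rows, the longest row first.\<close>

definition standard_tableaux :: "nat \<Rightarrow> nat list list set" where
  "standard_tableaux n = {T.
     [] \<notin> set T \<and> sorted_wrt (\<ge>) (map length T) \<and>
     distinct (concat T) \<and> set (concat T) = {1..n} \<and>
     (\<forall>r\<in>set T. sorted_wrt (<) r) \<and>
     (\<forall>i j. Suc i < length T \<and> j < length (T ! Suc i) \<longrightarrow> T ! i ! j < T ! Suc i ! j)}"

text \<open>Rows are numbered from 1, whereas list positions are numbered from 0.\<close>

definition row_index :: "nat list list \<Rightarrow> nat \<Rightarrow> nat" where
  "row_index T m = (THE i. 1 \<le> i \<and> i \<le> length T \<and> m \<in> set (T ! (i - 1)))"

definition yamanouchi_word :: "nat \<Rightarrow> nat list list \<Rightarrow> nat list" where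
  "yamanouchi_word n T = map (row_index T) [1..<Suc n]"

definition yamanouchi_words_3 :: "nat \<Rightarrow> nat list set" where
  "yamanouchi_words_3 n = yamanouchi_word n ` {T \<in> standard_tableaux n. length T \<le> 3}"


section \<open>The labelling procedure\<close>

text \<open>
  The steps of a path \<open>p\<close> are referred to by their positions \<open>0, \<dots>, length p - 1\<close> in the
  original path.  The current path is given by the set \<open>S\<close> of the positions that have not been
  labelled yet, so that removing steps and concatenating the remaining segments is set
  difference.  When \<open>p\<close> is a Motzkin path, no minimum or maximum of an empty set is
  taken; no convention is made for other lists of steps.
\<close>

definition round_labels :: "step list \<Rightarrow> nat set \<Rightarrow> nat \<rightharpoonup> nat" where
  "round_labels p S =
    (if p ! Min S = Level then [Min S \<mapsto> 1]
     else
       let j = Min {j \<in> S. p ! j \<noteq> Up};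
           i = Max {i \<in> S. i < j}
       in if p ! j = Down then [i \<mapsto> 1, j \<mapsto> 2]
          else let k = Min {k \<in> S. j < k \<and> p ! k = Down}
               in [i \<mapsto> 1, j \<mapsto> 2, k \<mapsto> 3])"

definition labelling :: "step list \<Rightarrow> nat \<rightharpoonup> nat" where
  "labelling p =
    snd (while (\<lambda>(S, l). S \<noteq> {})
               (\<lambda>(S, l). (S - dom (round_labels p S), l ++ round_labels p S))
               ({..<length p}, Map.empty))"

definition phi :: "step list \<Rightarrow> nat list" where
  "phi p = map (\<lambda>i. the (labelling p i)) [0..<length p]"


section \<open>Yamanouchi words in terms of prefixes\<close>

lemma standard_tableaux_row_index:
  assumes T: "T \<in> standard_tableaux n" and m: "m \<in> {1..n}"
  shows "row_index T m = i \<longleftrightarrow> 1 \<le> i \<and> i \<le> length T \<and> m \<in> set (T ! (i - 1))"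
proof -
  have disj: "a = b" if "a < length T" "b < length T" "m \<in> set (T ! a)" "m \<in> set (T ! b)" for a b
  proof (rule ccontr)
    assume "a \<noteq> b"
    have d: "distinct (concat T)" and ne: "[] \<notin> set T"
      using T by (auto simp: standard_tableaux_def)
    hence "distinct T"
      by (auto simp: distinct_concat_iff removeAll_id)
    hence "T ! a \<noteq> T ! b"
      using \<open>a \<noteq> b\<close> that by (simp add: nth_eq_iff_index_eq)
    hence "set (T ! a) \<inter> set (T ! b) = {}"
      using d that by (auto simp: distinct_concat_iff)
    thus False
      using that by blast
  qed
  have "m \<in> set (concat T)"
    using T m by (simp add: standard_tableaux_def)
  then obtain r where "r \<in> set T" "m \<in> set r"
    by auto
  then obtain a where a: "a < length T" "m \<in> set (T ! a)"
    by (auto simp: in_set_conv_nth)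
  have eq: "(1 \<le> i \<and> i \<le> length T \<and> m \<in> set (T ! (i - 1))) \<longleftrightarrow> i = Suc a" for i
    using a disj[of "i - 1" a] by auto
  show ?thesis
    unfolding row_index_def eq by auto
qed

lemma count_list_take_conv_card:
  assumes "length w = n" "k \<le> n"
  shows "count_list (take k w) i = card {m \<in> {1..k}. w ! (m - 1) = i}"
proof -
  have "count_list (take k w) i = card {m. m < k \<and> w ! m = i}"
    using assms by (auto simp: count_list_eq_length_filter length_filter_conv_card
        intro!: arg_cong[where f = card])
  also have "\<dots> = card (Suc ` {m. m < k \<and> w ! m = i})"
    by (simp add: card_image)
  also have "Suc ` {m. m < k \<and> w ! m = i} = {m \<in> {1..k}. w ! (m - 1) = i}"
  proof (intro set_eqI iffI)
    fix x assume "x \<in> {m \<in> {1..k}. w ! (m - 1) = i}"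
    thus "x \<in> Suc ` {m. m < k \<and> w ! m = i}"
      by (cases x) auto
  qed auto
  finally show ?thesis .
qed

lemma length_filter_le_conv_card:
  "distinct r \<Longrightarrow> length (filter (\<lambda>x. x \<le> k) r) = card {x \<in> set r. x \<le> (k::nat)}"
  using distinct_card[of "filter (\<lambda>x. x \<le> k) r"] by (simp)

theorem yamanouchi_words_3_iff:
  "w \<in> yamanouchi_words_3 n \<longleftrightarrow>
     length w = n \<and> set w \<subseteq> {1, 2, 3} \<and>
     (\<forall>k\<le>n. count_list (take k w) 2 \<le> count_list (take k w) 1 \<and>
             count_list (take k w) 3 \<le> count_list (take k w) 2)"
  (is "_ \<longleftrightarrow> ?R")
proof
  assume "w \<in> yamanouchi_words_3 n"
  then obtain T where T: "T \<in> standard_tableaux n" "length T \<le> 3" and w: "w = yamanouchi_word n T"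
    by (auto simp: yamanouchi_words_3_def)
  have len: "length w = n"
    by (simp add: w yamanouchi_word_def)
  have wn: "w ! (m - 1) = row_index T m" if "m \<in> {1..n}" for m
  proof -
    have "[1..<Suc n] ! (m - 1) = m" "m - 1 < length [1..<Suc n]"
      using that by (auto simp: nth_upt simp del: upt_Suc)
    thus ?thesis
      by (simp only: w yamanouchi_word_def nth_map)
  qed
  have letters: "set w \<subseteq> {1, 2, 3}"
  proof
    fix x assume "x \<in> set w"
    then obtain m where m: "m \<in> {1..n}" "x = row_index T m"
      by (auto simp: w yamanouchi_word_def less_Suc_eq_le simp del: upt_Suc)
    hence "1 \<le> x \<and> x \<le> 3"
      using standard_tableaux_row_index[OF T(1) m(1), of x] T(2) by auto
    thus "x \<in> {1, 2, 3}"
      by auto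
  qed
  have c: "count_list (take k w) i = (if i \<le> length T
      then card {j. j < length (T ! (i - 1)) \<and> T ! (i - 1) ! j \<le> k} else 0)"
    if "k \<le> n" "1 \<le> i" for k i
  proof -
    have *: "{m \<in> {1..k}. w ! (m - 1) = i} = {m \<in> {1..k}. i \<le> length T \<and> m \<in> set (T ! (i - 1))}"
    proof (intro Collect_cong conj_cong refl)
      fix m assume "m \<in> {1..k}"
      hence m: "m \<in> {1..n}"
        using that by simp
      show "w ! (m - 1) = i \<longleftrightarrow> i \<le> length T \<and> m \<in> set (T ! (i - 1))"
        using that(2) unfolding wn[OF m] standard_tableaux_row_index[OF T(1) m] by simp
    qed
    show ?thesis
    proof (cases "i \<le> length T")
      case True
      hence r: "T ! (i - 1) \<in> set T"
        using that by simp
      hence sub: "set (T ! (i - 1)) \<subseteq> {1..n}"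
        using T(1) by (auto simp: standard_tableaux_def)
      have "{m \<in> {1..k}. i \<le> length T \<and> m \<in> set (T ! (i - 1))} = {x \<in> set (T ! (i - 1)). x \<le> k}"
        using True sub by auto
      moreover have "distinct (T ! (i - 1))"
        using r T(1) by (auto simp: standard_tableaux_def distinct_concat_iff)
      ultimately show ?thesis
        using True that len * length_filter_le_conv_card[of "T ! (i - 1)" k]
        by (simp add: count_list_take_conv_card length_filter_conv_card)
    next
      case False
      thus ?thesis
        using that len * by (simp add: count_list_take_conv_card)
    qed
  qed
  have mono: "count_list (take k w) (Suc i) \<le> count_list (take k w) i" if "k \<le> n" "1 \<le> i" for k i
  proof (cases "Suc i \<le> length T")
    case True
    have a: "i = Suc (i - 1)"
      using that by simp
    define a where "a = i - 1"
    note a = a[folded a_def]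
    have 1: "length (T ! Suc a) \<le> length (T ! a)"
      using T(1) True a by (auto simp: standard_tableaux_def sorted_wrt_iff_nth_less)
    have 2: "T ! a ! j < T ! Suc a ! j" if "j < length (T ! Suc a)" for j
      using T(1) True a that by (auto simp: standard_tableaux_def)
    have "{j. j < length (T ! Suc a) \<and> T ! Suc a ! j \<le> k} \<subseteq> {j. j < length (T ! a) \<and> T ! a ! j \<le> k}"
      using 1 2 by force
    hence "card {j. j < length (T ! Suc a) \<and> T ! Suc a ! j \<le> k}
        \<le> card {j. j < length (T ! a) \<and> T ! a ! j \<le> k}"
      by (intro card_mono) auto
    thus ?thesis
      using c[OF that] c[OF that(1), of "Suc i"] True a by simp
  next
    case False
    thus ?thesis
      using c[OF that(1), of "Suc i"] by simp
  qed
  show ?R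
    using len letters mono[of _ 1] mono[of _ 2] by (simp add: numeral_eq_Suc)
next
  assume R: ?R
  hence len: "length w = n"
    by simp
  define row where "row i = filter (\<lambda>m. w ! (m - 1) = i) [1..<Suc n]" for i
  have set_row: "set (row i) = {m \<in> {1..n}. w ! (m - 1) = i}" for i
    by (auto simp: row_def simp del: upt_Suc)
  have sorted_row: "sorted_wrt (<) (row i)" for i
    unfolding row_def by (intro sorted_wrt_filter sorted_wrt_upt)
  have distinct_row: "distinct (row i)" for i
    by (simp add: row_def)
  have count_row: "count_list (take k w) i = card {j. j < length (row i) \<and> row i ! j \<le> k}"
    if "k \<le> n" for k i
  proof -
    have "{m \<in> {1..k}. w ! (m - 1) = i} = {x \<in> set (row i). x \<le> k}"
      using that by (auto simp: set_row)
    thus ?thesis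
      using length_filter_le_conv_card[OF distinct_row, of k i] that len
      by (simp add: count_list_take_conv_card length_filter_conv_card)
  qed
  have dom: "count_list (take k w) (Suc i) \<le> count_list (take k w) i"
    if "k \<le> n" "1 \<le> i" "i \<le> 2" for k i
  proof -
    have "i = 1 \<or> i = 2"
      using that by linarith
    thus ?thesis
      using R that by (auto simp: numeral_eq_Suc)
  qed
  have le_n: "row i ! j \<le> n" if "j < length (row i)" for i j
    using nth_mem[OF that] by (simp add: set_row)
  have length_row: "length (row i) = count_list (take n w) i" for i
  proof -
    have "{j. j < length (row i) \<and> row i ! j \<le> n} = {..<length (row i)}"
      using le_n by auto
    thus ?thesis
      using count_row[of n i] by simp
  qed
  have shape: "length (row (Suc i)) \<le> length (row i)" if "1 \<le> i" "i \<le> 2" for i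
    using dom[of n i] that by (simp add: length_row)
  have column: "row i ! j < row (Suc i) ! j"
    if i: "1 \<le> i" "i \<le> 2" and j: "j < length (row (Suc i))" for i j
  proof -
    let ?k = "row (Suc i) ! j"
    have "{..j} \<subseteq> {l. l < length (row (Suc i)) \<and> row (Suc i) ! l \<le> ?k}"
    proof
      fix l assume l: "l \<in> {..j}"
      hence "row (Suc i) ! l \<le> ?k"
        using sorted_wrt_nth_less[OF sorted_row, of l j "Suc i"] j by (cases "l = j") auto
      thus "l \<in> {l. l < length (row (Suc i)) \<and> row (Suc i) ! l \<le> ?k}"
        using l j by simp
    qed
    hence "card {..j} \<le> card {l. l < length (row (Suc i)) \<and> row (Suc i) ! l \<le> ?k}"
      by (intro card_mono) auto
    hence ge: "Suc j \<le> card {l. l < length (row i) \<and> row i ! l \<le> ?k}"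
      using dom[OF le_n[OF j] i] count_row[OF le_n[OF j]] by simp
    have "\<not> {l. l < length (row i) \<and> row i ! l \<le> ?k} \<subseteq> {..<j}"
    proof
      assume "{l. l < length (row i) \<and> row i ! l \<le> ?k} \<subseteq> {..<j}"
      from card_mono[OF _ this] ge show False
        by simp
    qed
    then obtain l where l: "j \<le> l" "l < length (row i)" "row i ! l \<le> ?k"
      unfolding subset_iff mem_Collect_eq lessThan_iff not_all not_imp not_less by (elim exE conjE)
    have jl: "row i ! j \<le> row i ! l"
      using sorted_wrt_nth_less[OF sorted_row, of j l i] l by (cases "l = j") auto
    have jj: "j < length (row i)"
      using l by simp
    have "row i ! j \<noteq> ?k"
      using nth_mem[OF jj] nth_mem[OF j] by (auto simp: set_row)
    thus ?thesis
      using jl l by simp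
  qed
  define r where "r = (if row 1 = [] then 0 else if row 2 = [] then 1
    else if row 3 = [] then 2 else (3::nat))"
  have r: "r \<le> 3" "1 \<le> i \<Longrightarrow> i \<le> 3 \<Longrightarrow> row i \<noteq> [] \<longleftrightarrow> i \<le> r" for i
  proof -
    have 1: "row 2 = []" if "row 1 = []"
      using shape[of 1] that by (simp add: numeral_2_eq_2)
    have 2: "row 3 = []" if "row 2 = []"
      using shape[of 2] that by (simp add: numeral_2_eq_2 numeral_3_eq_3)
    show "r \<le> 3"
      by (simp add: r_def)
    assume "1 \<le> i" "i \<le> 3"
    then consider "i = 1" | "i = 2" | "i = 3"
      by linarith
    thus "row i \<noteq> [] \<longleftrightarrow> i \<le> r"
      using 1 2 by cases (simp_all add: r_def del: One_nat_def)
  qed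
  define T where "T = map row [1..<Suc r]"
  have lenT: "length T = r"
    by (simp add: T_def)
  have T_nth: "T ! i = row (Suc i)" if "i < r" for i
    using that by (simp add: T_def del: upt_Suc)
  have setT: "set T = row ` {1..r}"
    by (simp add: T_def atLeastLessThanSuc_atLeastAtMost del: upt_Suc)
  have letter: "1 \<le> w ! (m - 1) \<and> w ! (m - 1) \<le> r" if "m \<in> {1..n}" for m
  proof -
    have "w ! (m - 1) \<in> set w"
      using that len by (intro nth_mem) auto
    hence *: "1 \<le> w ! (m - 1)" "w ! (m - 1) \<le> 3"
      using R by auto
    have "m \<in> set (row (w ! (m - 1)))"
      using that by (simp add: set_row)
    thus ?thesis
      using r(2)[OF *] * by auto
  qed
  have inj: "inj_on row {1..r}"
  proof (rule inj_onI)
    fix a b assume ab: "a \<in> {1..r}" "b \<in> {1..r}" "row a = row b"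
    hence "row a \<noteq> []"
      using r by simp
    then obtain x where "x \<in> set (row a)"
      by (meson last_in_set)
    thus "a = b"
      using ab by (metis (mono_tags, lifting) mem_Collect_eq set_row)
  qed
  have "T \<in> standard_tableaux n"
    unfolding standard_tableaux_def mem_Collect_eq
  proof (intro conjI allI impI ballI)
    show "[] \<notin> set T"
      using r by (force simp: setT)
    have mono: "length (row b) \<le> length (row a)" if "1 \<le> a" "a \<le> b" "b \<le> 3" for a b
      using that(2,1,3)
    proof (induction b rule: dec_induct)
      case (step m)
      thus ?case
        using shape[of m] by simp
    qed simp
    show "sorted_wrt (\<ge>) (map length T)"
      using r(1) by (auto simp: sorted_wrt_iff_nth_less lenT T_nth intro!: mono)
    have "distinct T"
      using inj by (simp add: T_def distinct_map atLeastLessThanSuc_atLeastAtMost del: upt_Suc)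
    thus "distinct (concat T)"
      by (auto simp: distinct_concat_iff setT distinct_row set_row distinct_removeAll)
    show "set (concat T) = {1..n}"
      using letter by (auto simp: setT set_row)
    show "sorted_wrt (<) x" if "x \<in> set T" for x
      using that sorted_row by (auto simp: setT)
    show "T ! i ! j < T ! Suc i ! j" if "Suc i < length T \<and> j < length (T ! Suc i)" for i j
      using that column[of "Suc i" j] r(1) by (auto simp: lenT T_nth)
  qed
  moreover from this have "row_index T (Suc m) = w ! m" if "m < n" for m
    using that letter[of "Suc m"]
    by (subst standard_tableaux_row_index) (auto simp: lenT T_nth set_row)
  hence "w = yamanouchi_word n T"
    using len by (intro nth_equalityI) (auto simp: yamanouchi_word_def simp del: upt_Suc)
  ultimately show "w \<in> yamanouchi_words_3 n"
    using r(1) lenT by (auto simp: yamanouchi_words_3_def)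
qed

end

theory Submission
  imports Defs
begin

text \<open>
  A single scan of the path from left to right produces the same labels as the rounds of the
  procedure.  The scan remembers two numbers: \<open>u\<close>, the number of up steps read that do not yet
  belong to a group \<open>1 2\<close> or \<open>1 2 3\<close>, and \<open>c\<close>, the number of level steps labelled \<open>2\<close> whose down
  step has not been read.  Every up step gets the label \<open>1\<close>.  A level step takes one of the \<open>u\<close>
  waiting up steps and gets the label \<open>2\<close>; if there is none, it heads the current path and gets
  the label \<open>1\<close>.  A down step is claimed by a level step that waits for it, if there is one,
  and gets the label \<open>3\<close>; otherwise it takes a waiting up step and gets the label \<open>2\<close>.  The
  height of the path is \<open>u + c\<close> throughout, so the scan of a Motzkin path starts and ends
  with \<open>u = c = 0\<close>.

  The point is that this transducer is also deterministic when it is run backwards.  A letter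
  \<open>3\<close> comes from a down step.  A letter \<open>2\<close> comes from a level step if \<open>c > 0\<close> after it, and from
  a down step if \<open>c = 0\<close> after it.  A letter \<open>1\<close> comes from an up step if \<open>u > 0\<close> after it, and
  from a level step if \<open>u = 0\<close> after it.  Hence every word on \<open>{1, 2, 3}\<close> can be read backwards
  from the state \<open>(0, 0)\<close> in exactly one way (\<open>unscan_scan\<close>, \<open>scan_unscan\<close>).  The state reached
  at the front has as \<open>u\<close> the largest excess of \<open>2\<close>s over \<open>1\<close>s in a prefix, and as \<open>c\<close> the
  largest excess of \<open>3\<close>s over \<open>2\<close>s (\<open>unscan_excess\<close>).  So it is \<open>(0, 0)\<close> exactly for the
  Yamanouchi words, and the scan is a bijection.

  It remains to match the scan with the rounds (\<open>phi_eq_scan\<close>).  The loop invariant says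
  that the current path consists of the waiting up steps to the left of the scanning position
  and of all positions to its right except the next \<open>c\<close> down steps, which have been
  labelled \<open>3\<close> in advance.
\<close>

section \<open>Paths that descend to the axis\<close>

fun descends :: "nat \<Rightarrow> step list \<Rightarrow> bool" where
  "descends h [] \<longleftrightarrow> h = 0"
| "descends h (Up # p) \<longleftrightarrow> descends (Suc h) p"
| "descends h (Level # p) \<longleftrightarrow> descends h p"
| "descends h (Down # p) \<longleftrightarrow> 0 < h \<and> descends (h - 1) p"

lemma all_le_Suc_conv: "(\<forall>k\<le>Suc n. P k) \<longleftrightarrow> P 0 \<and> (\<forall>k\<le>n. P (Suc k))"
  by (metis Suc_le_mono not0_implies_Suc zero_le)

lemma descends_iff_height:
  "descends h p \<longleftrightarrow>
     (\<forall>k\<le>length p. 0 \<le> int h + height p k) \<and> int h + height p (length p) = 0"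
proof (induction h p rule: descends.induct)
  case (1 h)
  show ?case by (auto simp: height_def)
next
  case (2 h p)
  show ?case by (simp add: 2 all_le_Suc_conv) (auto simp: height_def algebra_simps)
next
  case (3 h p)
  show ?case by (simp add: 3 all_le_Suc_conv) (auto simp: height_def algebra_simps)
next
  case (4 h p)
  show ?case
  proof (cases h)
    case 0
    then show ?thesis by (auto simp: all_le_Suc_conv height_def dest: spec[of _ 0])
  next
    case (Suc h')
    then show ?thesis
      using 4 by (simp add: all_le_Suc_conv) (auto simp: height_def algebra_simps)
  qed
qed

lemma motzkin_paths_iff_descends: "p \<in> motzkin_paths n \<longleftrightarrow> length p = n \<and> descends 0 p"
  by (auto simp: motzkin_paths_def descends_iff_height)

lemma descends_count_Down: "descends h p \<Longrightarrow> h \<le> count_list p Down"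
  by (induction h p rule: descends.induct) auto


section \<open>The scan and its inverse\<close>

text \<open>
  The last equation concerns a down step at height \<open>0\<close>, which does not occur in a path that
  satisfies \<open>descends (u + c)\<close>.
\<close>

fun scan :: "nat \<Rightarrow> nat \<Rightarrow> step list \<Rightarrow> nat list" where
  "scan u c [] = []"
| "scan u c (Up # p) = 1 # scan (Suc u) c p"
| "scan 0 c (Level # p) = 1 # scan 0 c p"
| "scan (Suc u) c (Level # p) = 2 # scan u (Suc c) p"
| "scan u (Suc c) (Down # p) = 3 # scan u c p"
| "scan (Suc u) 0 (Down # p) = 2 # scan u 0 p"
| "scan 0 0 (Down # p) = 0 # scan 0 0 p"

text \<open>
  Reading a word from right to left: the result is the state before its first letter together
  with the path.
\<close>

fun unscan :: "nat list \<Rightarrow> nat \<times> nat \<times> step list" where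
  "unscan [] = (0, 0, [])"
| "unscan (x # w) = (case unscan w of (u, c, p) \<Rightarrow>
     if x = 3 then (u, Suc c, Down # p)
     else if x = 2 then (if c = 0 then (Suc u, 0, Down # p) else (Suc u, c - 1, Level # p))
     else (if u = 0 then (0, c, Level # p) else (u - 1, c, Up # p)))"

lemma length_scan [simp]: "length (scan u c p) = length p"
  by (induction u c p rule: scan.induct) auto

lemma set_scan: "descends (u + c) p \<Longrightarrow> set (scan u c p) \<subseteq> {1, 2, 3}"
  by (induction u c p rule: scan.induct) auto

lemma unscan_scan: "descends (u + c) p \<Longrightarrow> unscan (scan u c p) = (u, c, p)"
  by (induction u c p rule: scan.induct) auto

lemma scan_unscan:
  assumes "set w \<subseteq> {1, 2, 3}" "unscan w = (u, c, p)"
  shows "descends (u + c) p \<and> scan u c p = w"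
  using assms
proof (induction w arbitrary: u c p)
  case (Cons x w)
  obtain u' c' p' where w: "unscan w = (u', c', p')"
    by (cases "unscan w")
  have IH: "descends (u' + c') p' \<and> scan u' c' p' = w"
    using Cons.IH[OF _ w] Cons.prems(1) by simp
  have "x = 1 \<or> x = 2 \<or> x = 3"
    using Cons.prems(1) by auto
  then show ?case
    using IH Cons.prems(2) w by (cases u'; cases c') auto
qed simp

text \<open>
  Putting a letter in front of a word shifts the excess of every nonempty prefix by the same
  amount and adds the empty prefix, whose excess is \<open>0\<close>.  The backward steps change the counters
  in the same way, with subtraction truncated at \<open>0\<close>; hence they hold maxima over prefixes.  The
  bounds \<open>a\<close> and \<open>b\<close> are arbitrary so that the induction can absorb these shifts.
\<close>

lemma unscan_excess:
  assumes "set w \<subseteq> {1, 2, 3}" "unscan w = (u, c, p)"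
  shows "u \<le> a \<and> c \<le> b \<longleftrightarrow>
    (\<forall>k\<le>length w. count_list (take k w) 2 \<le> count_list (take k w) 1 + a \<and>
                   count_list (take k w) 3 \<le> count_list (take k w) 2 + b)"
  using assms
proof (induction w arbitrary: u c p a b)
  case (Cons x w)
  obtain u' c' p' where w: "unscan w = (u', c', p')"
    by (cases "unscan w")
  note IH = Cons.IH[OF _ w]
  have sub: "set w \<subseteq> {1, 2, 3}"
    using Cons.prems(1) by simp
  have "x = 1 \<or> x = 2 \<or> x = 3"
    using Cons.prems(1) by auto
  then consider "x = 1" | "x = 2" "a = 0" | a' where "x = 2" "a = Suc a'"
    | "x = 3" "b = 0" | b' where "x = 3" "b = Suc b'"
    by (metis not0_implies_Suc)
  then show ?case
  proof cases
    case 1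
    then show ?thesis
      using Cons.prems(2) w IH[of "Suc a" b, OF sub]
      by (auto simp: all_le_Suc_conv split: if_splits)
  next
    case 2
    then show ?thesis
      using Cons.prems(2) w by (auto simp: all_le_Suc_conv split: if_splits intro!: exI[of _ 0])
  next
    case 3
    then show ?thesis
      using Cons.prems(2) w IH[of a' "Suc b", OF sub]
      by (auto simp: all_le_Suc_conv split: if_splits)
  next
    case 4
    then show ?thesis
      using Cons.prems(2) w by (auto simp: all_le_Suc_conv split: if_splits intro!: exI[of _ 0])
  next
    case 5
    then show ?thesis
      using Cons.prems(2) w IH[of a b', OF sub]
      by (auto simp: all_le_Suc_conv split: if_splits)
  qed
qed simp

theorem bij_betw_scan: "bij_betw (scan 0 0) (motzkin_paths n) (yamanouchi_words_3 n)"
proof (rule bij_betw_imageI)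
  show "inj_on (scan 0 0) (motzkin_paths n)"
  proof (rule inj_onI)
    fix p q
    assume p: "p \<in> motzkin_paths n" and q: "q \<in> motzkin_paths n"
      and eq: "scan 0 0 p = scan 0 0 q"
    have "(0, 0, p) = unscan (scan 0 0 p)"
      using p by (simp add: unscan_scan motzkin_paths_iff_descends)
    also have "\<dots> = (0, 0, q)"
      unfolding eq using q by (simp add: unscan_scan motzkin_paths_iff_descends)
    finally show "p = q"
      by simp
  qed
  show "scan 0 0 ` motzkin_paths n = yamanouchi_words_3 n"
  proof (intro set_eqI iffI)
    fix w assume "w \<in> scan 0 0 ` motzkin_paths n"
    then obtain p where "length p = n" "descends 0 p" "w = scan 0 0 p"
      by (auto simp: motzkin_paths_iff_descends)
    then show "w \<in> yamanouchi_words_3 n"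
      using set_scan[of 0 0 p] unscan_scan[of 0 0 p] unscan_excess[of w 0 0 p 0 0]
      by (simp add: yamanouchi_words_3_iff)
  next
    fix w assume w: "w \<in> yamanouchi_words_3 n"
    obtain u c p where ucp: "unscan w = (u, c, p)"
      by (cases "unscan w")
    have "u = 0" "c = 0"
      using w unscan_excess[OF _ ucp, of 0 0] by (simp_all add: yamanouchi_words_3_iff)
    then have "descends 0 p" "scan 0 0 p = w"
      using w scan_unscan[OF _ ucp] by (simp_all add: yamanouchi_words_3_iff)
    moreover from this have "length p = n"
      using w by (auto simp: yamanouchi_words_3_iff)
    ultimately show "w \<in> scan 0 0 ` motzkin_paths n"
      by (auto simp: motzkin_paths_iff_descends)
  qed
qed


section \<open>The rounds of the procedure follow the scan\<close>

text \<open>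
  The positions of the first \<open>c\<close> down steps of a path, where \<open>t\<close> is the position of its first
  step.  Recursion along the path makes the change from \<open>t\<close> to \<open>Suc t\<close> a defining equation.
\<close>

fun claimed :: "nat \<Rightarrow> nat \<Rightarrow> step list \<Rightarrow> nat set" where
  "claimed t c [] = {}"
| "claimed t 0 (x # q) = {}"
| "claimed t (Suc c) (Down # q) = insert t (claimed (Suc t) c q)"
| "claimed t (Suc c) (x # q) = claimed (Suc t) (Suc c) q"

lemma claimed_0 [simp]: "claimed t 0 q = {}"
  by (cases q) auto

lemma claimed_not_Down: "x \<noteq> Down \<Longrightarrow> claimed t c (x # q) = claimed (Suc t) c q"
  by (cases c; cases x) auto

lemma claimed_ge: "k \<in> claimed t c q \<Longrightarrow> t \<le> k"
  by (induction t c q rule: claimed.induct) auto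

text \<open>
  This is why choosing the first down step of the current path after a level step keeps the
  claimed down steps an initial segment of all those ahead.
\<close>

lemma claimed_Suc:
  assumes "c < count_list q Down"
  shows "\<exists>k. claimed t (Suc c) q = insert k (claimed t c q) \<and> k \<notin> claimed t c q \<and>
           t \<le> k \<and> k < t + length q \<and> q ! (k - t) = Down \<and>
           (\<forall>m. t \<le> m \<and> m < k \<and> q ! (m - t) = Down \<longrightarrow> m \<in> claimed t c q)"
  using assms
proof (induction q arbitrary: t c)
  case (Cons x q)
  show ?case
  proof (cases "x = Down \<and> c = 0")
    case True
    then show ?thesis by auto
  next
    case False
    define d where "d = (if x = Down then c - 1 else c)"
    have "d < count_list q Down"
      using Cons.prems False by (auto simp: d_def)
    from Cons.IH[OF this, of "Suc t"] obtain k where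
      k: "claimed (Suc t) (Suc d) q = insert k (claimed (Suc t) d q)"
        "k \<notin> claimed (Suc t) d q" "Suc t \<le> k" "k < Suc t + length q" "q ! (k - Suc t) = Down"
        "\<And>m. Suc t \<le> m \<Longrightarrow> m < k \<Longrightarrow> q ! (m - Suc t) = Down \<Longrightarrow> m \<in> claimed (Suc t) d q"
      by blast
    have shift: "(x # q) ! (m - t) = q ! (m - Suc t)" if "Suc t \<le> m" for m
      using that by (simp add: nth_Cons')
    show ?thesis
    proof (cases "x = Down")
      case True
      then have c: "c = Suc d"
        using False by (cases c) (auto simp: d_def)
      have "m \<in> claimed t c (x # q)" if "t \<le> m" "m < k" "(x # q) ! (m - t) = Down" for m
        using that k(6)[of m] shift[of m] True c by (cases "m = t") auto
      then show ?thesis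
        using k True c shift[of k] by (intro exI[of _ k]) auto
    next
      case False
      then have d: "d = c"
        by (simp add: d_def)
      have "m \<in> claimed t c (x # q)" if "t \<le> m" "m < k" "(x # q) ! (m - t) = Down" for m
        using that k(6)[of m] shift[of m] False d by (cases "m = t") (auto simp: claimed_not_Down)
      then show ?thesis
        using k False d shift[of k] by (intro exI[of _ k]) (auto simp: claimed_not_Down)
    qed
  qed
qed simp

text \<open>
  \<open>t\<close> is the position that the scan reads next, and \<open>A\<close> is the set of the waiting up steps, so
  that the state of the scan is \<open>(card A, c)\<close>.  The claimed down steps carry the label \<open>3\<close> already,
  although the scan has not reached them; that it is the label which the scan gives them is
  seen when it does.
\<close>

definition scan_inv ::
    "step list \<Rightarrow> nat \<Rightarrow> nat set \<Rightarrow> nat \<Rightarrow> nat set \<Rightarrow> (nat \<rightharpoonup> nat) \<Rightarrow> bool" where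
  "scan_inv p t A c S l \<longleftrightarrow>
     t \<le> length p \<and> A \<subseteq> {..<t} \<and>
     (\<forall>i\<in>A. p ! i = Up \<and> scan 0 0 p ! i = 1) \<and>
     S = A \<union> ({t..<length p} - claimed t c (drop t p)) \<and>
     descends (card A + c) (drop t p) \<and>
     drop t (scan 0 0 p) = scan (card A) c (drop t p) \<and>
     (\<forall>i\<in>{..<t} - A. l i = Some (scan 0 0 p ! i)) \<and>
     (\<forall>i\<in>claimed t c (drop t p). l i = Some 3)"

lemma drop_eq_ConsD:
  assumes "drop t w = x # v"
  shows "w ! t = x" "drop (Suc t) w = v"
proof -
  have "t < length w"
    using assms by (metis drop_all list.distinct(1) not_le)
  then show "w ! t = x" "drop (Suc t) w = v"
    using assms by (simp_all flip: Cons_nth_drop_Suc)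
qed

lemma scan_invI:
  assumes "t \<le> length p" "A \<subseteq> {..<t}"
    "\<And>i. i \<in> A \<Longrightarrow> p ! i = Up" "\<And>i. i \<in> A \<Longrightarrow> scan 0 0 p ! i = 1"
    "S = A \<union> ({t..<length p} - claimed t c (drop t p))"
    "descends (card A + c) (drop t p)"
    "drop t (scan 0 0 p) = scan (card A) c (drop t p)"
    "\<And>i. i < t \<Longrightarrow> i \<notin> A \<Longrightarrow> l i = Some (scan 0 0 p ! i)"
    "\<And>i. i \<in> claimed t c (drop t p) \<Longrightarrow> l i = Some 3"
  shows "scan_inv p t A c S l"
  using assms unfolding scan_inv_def by blast

lemma remove_pair:
  fixes S A :: "nat set"
  assumes S: "S = A \<union> {t..<n}" and A: "\<And>i. i \<in> A \<Longrightarrow> i < t" and i: "i < t" "i \<in> A"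
  shows "S - dom [i \<mapsto> 1, t \<mapsto> 2 :: nat] = A - {i} \<union> {Suc t..<n}"
proof (rule set_eqI)
  fix m
  show "m \<in> S - dom [i \<mapsto> 1, t \<mapsto> 2 :: nat] \<longleftrightarrow> m \<in> A - {i} \<union> {Suc t..<n}"
    using A[of m] i unfolding S by (auto split: if_splits)
qed

lemma remove_triple:
  fixes S A :: "nat set"
  assumes S: "S = A \<union> ({t..<n} - B)" and A: "\<And>i. i \<in> A \<Longrightarrow> i < t"
    and i: "i < t" "i \<in> A" "t < k" "t \<notin> B"
  shows "S - dom [i \<mapsto> 1, t \<mapsto> 2, k \<mapsto> 3 :: nat] = A - {i} \<union> ({Suc t..<n} - insert k B)"
proof (rule set_eqI)
  fix m
  show "m \<in> S - dom [i \<mapsto> 1, t \<mapsto> 2, k \<mapsto> 3 :: nat] \<longleftrightarrow> m \<in> A - {i} \<union> ({Suc t..<n} - insert k B)"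
    using A[of m] i unfolding S by (auto split: if_splits)
qed

context
  fixes p t A c S l
  assumes inv: "scan_inv p t A c S l" and t: "t < length p"
begin

lemma drop_p: "drop t p = p ! t # drop (Suc t) p"
  using t by (simp add: Cons_nth_drop_Suc)

lemma waiting: "A \<subseteq> {..<t}" "\<And>i. i \<in> A \<Longrightarrow> i < t" "finite A"
    "\<And>i. i \<in> A \<Longrightarrow> p ! i = Up" "\<And>i. i \<in> A \<Longrightarrow> scan 0 0 p ! i = 1" "t \<notin> A"
    "A \<subseteq> {..<Suc t}"
  using inv finite_subset[of A "{..<t}"] by (auto simp: scan_inv_def less_Suc_eq)

lemma current_path: "S = A \<union> ({t..<length p} - claimed t c (p ! t # drop (Suc t) p))"
  using inv by (simp add: scan_inv_def drop_p)

lemma path_ahead: "descends (card A + c) (p ! t # drop (Suc t) p)"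
  using inv by (simp add: scan_inv_def drop_p)

lemma word_ahead: "drop t (scan 0 0 p) = scan (card A) c (p ! t # drop (Suc t) p)"
  using inv by (simp add: scan_inv_def drop_p)

lemma old_labels: "i < t \<Longrightarrow> i \<notin> A \<Longrightarrow> l i = Some (scan 0 0 p ! i)"
    "i \<in> claimed t c (p ! t # drop (Suc t) p) \<Longrightarrow> l i = Some 3"
  using inv by (auto simp: scan_inv_def drop_p)

lemma scan_inv_Up:
  assumes Up: "p ! t = Up"
  shows "scan_inv p (Suc t) (insert t A) c S l"
proof -
  have w: "scan 0 0 p ! t = 1" "drop (Suc t) (scan 0 0 p) = scan (Suc (card A)) c (drop (Suc t) p)"
    using drop_eq_ConsD[of t "scan 0 0 p"] word_ahead Up by simp_all
  have cl: "claimed t c (p ! t # drop (Suc t) p) = claimed (Suc t) c (drop (Suc t) p)"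
    using Up by (simp add: claimed_not_Down)
  show ?thesis
  proof (rule scan_invI)
    show "S = insert t A \<union> ({Suc t..<length p} - claimed (Suc t) c (drop (Suc t) p))"
      using current_path t claimed_ge[of t "Suc t"] unfolding cl by fastforce
    show "descends (card (insert t A) + c) (drop (Suc t) p)"
      using path_ahead Up waiting by simp
  qed (use w waiting Up t old_labels cl in \<open>auto simp: less_Suc_eq\<close>)
qed

lemma scan_inv_claimed_Down:
  assumes Down: "p ! t = Down" and c: "c = Suc c'"
  shows "scan_inv p (Suc t) A c' S l"
proof -
  have w: "scan 0 0 p ! t = 3" "drop (Suc t) (scan 0 0 p) = scan (card A) c' (drop (Suc t) p)"
    using drop_eq_ConsD[of t "scan 0 0 p"] word_ahead Down c by simp_all
  have cl: "claimed t c (p ! t # drop (Suc t) p) = insert t (claimed (Suc t) c' (drop (Suc t) p))"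
    using Down c by simp
  show ?thesis
  proof (rule scan_invI)
    show "S = A \<union> ({Suc t..<length p} - claimed (Suc t) c' (drop (Suc t) p))"
      using current_path unfolding cl by auto
    show "descends (card A + c') (drop (Suc t) p)"
      using path_ahead Down c by simp
    show "l i = Some (scan 0 0 p ! i)" if "i < Suc t" "i \<notin> A" for i
      using that old_labels w cl by (auto simp: less_Suc_eq)
  qed (use w waiting t old_labels cl in auto)
qed

text \<open>
  At a level step, or at a down step when none is claimed, the scan has reached the step
  \<open>x\<^sub>j\<close> of the current path (or its first step, if that is level), and a round takes place.
\<close>

context
  assumes stop: "p ! t = Level \<or> p ! t = Down \<and> c = 0"
begin

lemma t_in_S: "t \<in> S"
proof -
  have "t \<notin> claimed t c (p ! t # drop (Suc t) p)"
    using stop claimed_ge[of t "Suc t"] by (fastforce simp: claimed_not_Down)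
  then show ?thesis
    using current_path t by simp
qed

lemma finite_S: "finite S"
  using current_path waiting by simp

lemma first_not_Up: "Min {j \<in> S. p ! j \<noteq> Up} = t"
proof (rule Min_eqI)
  show "t \<in> {j \<in> S. p ! j \<noteq> Up}"
    using t_in_S stop by auto
qed (use finite_S current_path waiting in auto)

lemma before_t: "{i \<in> S. i < t} = A"
  using current_path waiting by auto

lemma Min_S_Up: "A \<noteq> {} \<Longrightarrow> p ! Min S = Up"
proof -
  assume "A \<noteq> {}"
  then obtain a where a: "a \<in> A"
    by blast
  have "Min S \<in> S"
    using finite_S t_in_S by (intro Min_in) auto
  moreover have "Min S \<le> a"
    using finite_S a current_path by (intro Min_le) auto
  ultimately have "Min S \<in> A"
    using a waiting(2) before_t by (metis (mono_tags, lifting) le_less_trans mem_Collect_eq)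
  then show ?thesis
    using waiting by blast
qed

lemma Min_S_t: "A = {} \<Longrightarrow> Min S = t"
  using finite_S t_in_S current_path by (intro Min_eqI) auto

lemma scan_inv_round:
  "\<exists>A' c'. scan_inv p (Suc t) A' c' (S - dom (round_labels p S)) (l ++ round_labels p S) \<and>
     t \<in> dom (round_labels p S)"
proof (cases "A = {}")
  case True
  \<comment> \<open>The height is \<open>card A + c\<close>, so with \<open>A = {}\<close> and \<open>c = 0\<close> a down step would leave the half-plane.\<close>
  have Level: "p ! t = Level"
    using stop path_ahead True by auto
  have w: "scan 0 0 p ! t = 1" "drop (Suc t) (scan 0 0 p) = scan (card A) c (drop (Suc t) p)"
    using drop_eq_ConsD[of t "scan 0 0 p"] word_ahead Level True by simp_all
  have cl: "claimed t c (p ! t # drop (Suc t) p) = claimed (Suc t) c (drop (Suc t) p)"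
    using Level by (simp add: claimed_not_Down)
  have r: "round_labels p S = [t \<mapsto> 1]"
    using Min_S_t[OF True] Level by (simp add: round_labels_def)
  have "scan_inv p (Suc t) A c (S - dom (round_labels p S)) (l ++ round_labels p S)"
    unfolding r
  proof (rule scan_invI)
    show "S - dom [t \<mapsto> 1 :: nat] = A \<union> ({Suc t..<length p} - claimed (Suc t) c (drop (Suc t) p))"
      using current_path waiting True unfolding cl by auto
    show "descends (card A + c) (drop (Suc t) p)"
      using path_ahead Level by simp
    show "(l ++ [t \<mapsto> 1]) i = Some (scan 0 0 p ! i)" if "i < Suc t" "i \<notin> A" for i
      using that old_labels w by (auto simp: less_Suc_eq)
    show "(l ++ [t \<mapsto> 1]) i = Some 3" if "i \<in> claimed (Suc t) c (drop (Suc t) p)" for i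
      using that old_labels(2)[of i] claimed_ge[OF that] unfolding cl by auto
  qed (use w waiting t True in auto)
  then show ?thesis
    using r by auto
next
  case False
  \<comment> \<open>\<open>A\<close> is the part of the current path before \<open>t\<close>, so \<open>i\<close> is the position of \<open>x\<^sub>j\<^sub>-\<^sub>1\<close>.\<close>
  define i where "i = Max A"
  define u where "u = card A - 1"
  have i: "i \<in> A" "i < t"
    using waiting False by (auto simp: i_def)
  have u: "card A = Suc u" "card (A - {i}) = u"
    using waiting False i by (auto simp: u_def card_gt_0_iff)
  note not_level = Min_S_Up[OF False]
  show ?thesis
  proof (cases "p ! t = Down")
    case True
    have c: "c = 0"
      using stop True by simp
    have w: "scan 0 0 p ! t = 2" "drop (Suc t) (scan 0 0 p) = scan u c (drop (Suc t) p)"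
      using drop_eq_ConsD[of t "scan 0 0 p"] word_ahead True u c by simp_all
    have r: "round_labels p S = [i \<mapsto> 1, t \<mapsto> 2]"
      using not_level True by (simp add: round_labels_def first_not_Up before_t i_def)
    have "scan_inv p (Suc t) (A - {i}) c (S - dom (round_labels p S)) (l ++ round_labels p S)"
      unfolding r
    proof (rule scan_invI)
      show "S - dom [i \<mapsto> 1, t \<mapsto> 2 :: nat] =
          A - {i} \<union> ({Suc t..<length p} - claimed (Suc t) c (drop (Suc t) p))"
        using remove_pair[OF _ waiting(2) i(2,1)] current_path c by simp
      show "descends (card (A - {i}) + c) (drop (Suc t) p)"
        using path_ahead True c u by simp
      show "(l ++ [i \<mapsto> 1, t \<mapsto> 2]) m = Some (scan 0 0 p ! m)" if m: "m < Suc t" "m \<notin> A - {i}" for m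
      proof -
        consider "m = t" | "m = i" | "m < t" "m \<notin> A" "m \<noteq> i"
          using m unfolding less_Suc_eq by blast
        then show ?thesis
          using i(2) w(1) old_labels(1) waiting(5)[OF i(1)] by cases simp_all
      qed
      show "A - {i} \<subseteq> {..<Suc t}"
        using waiting(7) by blast
      show "p ! m = Up" "scan 0 0 p ! m = 1" if "m \<in> A - {i}" for m
        using that waiting(4,5) by blast+
      show "drop (Suc t) (scan 0 0 p) = scan (card (A - {i})) c (drop (Suc t) p)"
        unfolding u(2) by (rule w(2))
      show "(l ++ [i \<mapsto> 1, t \<mapsto> 2]) m = Some 3" if "m \<in> claimed (Suc t) c (drop (Suc t) p)" for m
        using that c by simp
    qed (use t in simp)
    then show ?thesis
      using r by auto
  next
    case not_Down: False
    then have Level: "p ! t = Level"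
      using stop by simp
    have w: "scan 0 0 p ! t = 2" "drop (Suc t) (scan 0 0 p) = scan u (Suc c) (drop (Suc t) p)"
      using drop_eq_ConsD[of t "scan 0 0 p"] word_ahead Level u by simp_all
    have cl: "claimed t c (p ! t # drop (Suc t) p) = claimed (Suc t) c (drop (Suc t) p)"
      using Level by (simp add: claimed_not_Down)
    have path_ahead': "descends (u + Suc c) (drop (Suc t) p)"
      using path_ahead Level u by simp
    \<comment> \<open>
      The path descends from height \<open>card A + c\<close>, and \<open>A \<noteq> {}\<close>, so it has a down step beyond
      the \<open>c\<close> claimed ones: this is why the third step of the group exists.\<close>
    have "c < count_list (drop (Suc t) p) Down"
      using descends_count_Down[OF path_ahead'] by simp
    from claimed_Suc[OF this, of "Suc t"] obtain k where
      k: "claimed (Suc t) (Suc c) (drop (Suc t) p) = insert k (claimed (Suc t) c (drop (Suc t) p))"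
        "k \<notin> claimed (Suc t) c (drop (Suc t) p)" "t < k" "k < length p" "p ! k = Down"
        "\<And>m. t < m \<Longrightarrow> m < k \<Longrightarrow> p ! m = Down \<Longrightarrow> m \<in> claimed (Suc t) c (drop (Suc t) p)"
      using t by (auto simp: Suc_le_eq)
    have Min_k: "Min {k \<in> S. t < k \<and> p ! k = Down} = k"
    proof (rule Min_eqI)
      show "k \<in> {k \<in> S. t < k \<and> p ! k = Down}"
        using k current_path unfolding cl by auto
      show "k \<le> m" if "m \<in> {k \<in> S. t < k \<and> p ! k = Down}" for m
        using that k(6)[of m] current_path waiting unfolding cl by (force simp flip: not_less)
    qed (use finite_S in simp)
    have r: "round_labels p S = [i \<mapsto> 1, t \<mapsto> 2, k \<mapsto> 3]"
      using not_level not_Down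
      by (simp add: round_labels_def first_not_Up before_t i_def Min_k)
    have "scan_inv p (Suc t) (A - {i}) (Suc c)
        (S - dom (round_labels p S)) (l ++ round_labels p S)"
      unfolding r
    proof (rule scan_invI)
      show "S - dom [i \<mapsto> 1, t \<mapsto> 2, k \<mapsto> 3 :: nat] =
          A - {i} \<union> ({Suc t..<length p} - claimed (Suc t) (Suc c) (drop (Suc t) p))"
        unfolding k(1)
        using claimed_ge[of t "Suc t" c "drop (Suc t) p"]
        by (intro remove_triple[OF _ waiting(2) i(2,1) k(3)] current_path[unfolded cl]) auto
      show "descends (card (A - {i}) + Suc c) (drop (Suc t) p)"
        using path_ahead' u by simp
      show "(l ++ [i \<mapsto> 1, t \<mapsto> 2, k \<mapsto> 3]) m = Some (scan 0 0 p ! m)"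
        if m: "m < Suc t" "m \<notin> A - {i}" for m
      proof -
        consider "m = t" | "m = i" | "m < t" "m \<notin> A" "m \<noteq> i"
          using m unfolding less_Suc_eq by blast
        then show ?thesis
          using i(2) k(3) w(1) old_labels(1) waiting(5)[OF i(1)] by cases simp_all
      qed
      show "A - {i} \<subseteq> {..<Suc t}"
        using waiting(7) by blast
      show "(l ++ [i \<mapsto> 1, t \<mapsto> 2, k \<mapsto> 3]) m = Some 3"
        if "m \<in> claimed (Suc t) (Suc c) (drop (Suc t) p)" for m
        using that old_labels(2)[of m] claimed_ge[OF that] i unfolding cl k(1) by auto
      show "p ! m = Up" "scan 0 0 p ! m = 1" if "m \<in> A - {i}" for m
        using that waiting(4,5) by blast+
      show "drop (Suc t) (scan 0 0 p) = scan (card (A - {i})) (Suc c) (drop (Suc t) p)"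
        unfolding u(2) by (rule w(2))
    qed (use t in simp)
    then show ?thesis
      using r by auto
  qed
qed

end

end

text \<open>
  Between two rounds the scan passes over up steps and over down steps that are already
  labelled; neither changes the current path.
\<close>

lemma scan_inv_advance:
  assumes "scan_inv p t A c S l"
  shows "\<exists>t A c. scan_inv p t A c S l \<and>
    (t < length p \<longrightarrow> p ! t = Level \<or> p ! t = Down \<and> c = 0)"
  using assms
proof (induction "length p - t" arbitrary: t A c rule: less_induct)
  case less
  show ?case
  proof (cases "t < length p")
    case True
    have *: "length p - Suc t < length p - t"
      using True by simp
    consider "p ! t = Level \<or> p ! t = Down \<and> c = 0" | "p ! t = Up"
      | c' where "p ! t = Down" "c = Suc c'"
      by (metis not0_implies_Suc step.exhaust)
    then show ?thesis
    proof cases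
      case 1
      then show ?thesis using less.prems by blast
    next
      case 2
      show ?thesis by (rule less.hyps[OF * scan_inv_Up[OF less.prems True 2]])
    next
      case 3
      show ?thesis by (rule less.hyps[OF * scan_inv_claimed_Down[OF less.prems True 3]])
    qed
  next
    case False
    then show ?thesis using less.prems by blast
  qed
qed

lemma scan_inv_end:
  assumes "scan_inv p (length p) A c S l"
  shows "S = {} \<and> (\<forall>i<length p. l i = Some (scan 0 0 p ! i))"
proof -
  have "finite A"
    using assms finite_subset[of A "{..<length p}"] by (auto simp: scan_inv_def)
  then have "A = {}"
    using assms by (simp add: scan_inv_def)
  then show ?thesis
    using assms by (auto simp: scan_inv_def)
qed

theorem phi_eq_scan:
  assumes "descends 0 p"
  shows "phi p = scan 0 0 p"
proof -
  have step: "(\<exists>t A c. scan_inv p t A c (S - dom (round_labels p S)) (l ++ round_labels p S)) \<and>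
      S \<inter> dom (round_labels p S) \<noteq> {} \<and> finite S"
    if hyps: "scan_inv p t A c S l" "S \<noteq> {}" for t A c S l
  proof -
    obtain t A c where inv: "scan_inv p t A c S l"
      and stop: "t < length p \<longrightarrow> p ! t = Level \<or> p ! t = Down \<and> c = 0"
      using scan_inv_advance[OF hyps(1)] by blast
    have "t < length p"
    proof (rule ccontr)
      assume "\<not> t < length p"
      then have "t = length p"
        using inv by (simp add: scan_inv_def)
      then show False
        using scan_inv_end inv hyps(2) by blast
    qed
    then show ?thesis
      using scan_inv_round[OF inv] t_in_S[OF inv] finite_S[OF inv] stop by blast
  qed
  let ?b = "\<lambda>(S, l). S \<noteq> ({} :: nat set)"
  let ?f = "\<lambda>(S, l). (S - dom (round_labels p S), l ++ round_labels p S)"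
  define I where "I = (\<lambda>(S, l). \<exists>t A c. scan_inv p t A c S l)"
  have "\<forall>i<length p. snd (while ?b ?f ({..<length p}, Map.empty)) i = Some (scan 0 0 p ! i)"
  proof (rule while_rule[where P = I and r = "measure (\<lambda>(S, l). card S)"])
    have "scan_inv p 0 {} 0 {..<length p} Map.empty"
      using assms by (intro scan_invI) auto
    then show "I ({..<length p}, Map.empty)"
      unfolding I_def by blast
  next
    fix s :: "nat set \<times> (nat \<rightharpoonup> nat)"
    obtain S l where s: "s = (S, l)" by (cases s)
    assume "I s" "?b s"
    then show "I (?f s)"
      using step unfolding I_def s prod.case by blast
  next
    fix s :: "nat set \<times> (nat \<rightharpoonup> nat)"
    obtain S l where s: "s = (S, l)" by (cases s)
    assume "I s" "?b s"
    then have "S \<inter> dom (round_labels p S) \<noteq> {}" "finite S"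
      using step unfolding I_def s prod.case by blast+
    then show "(?f s, s) \<in> measure (\<lambda>(S, l). card S)"
      unfolding s by (auto intro!: psubset_card_mono)
  next
    fix s :: "nat set \<times> (nat \<rightharpoonup> nat)"
    obtain S l where s: "s = (S, l)" by (cases s)
    assume "I s" "\<not> ?b s"
    then obtain t A c where inv: "scan_inv p t A c S l" and "S = {}"
      unfolding I_def s prod.case by blast
    obtain t A c where inv: "scan_inv p t A c S l"
      and stop: "t < length p \<longrightarrow> p ! t = Level \<or> p ! t = Down \<and> c = 0"
      using scan_inv_advance[OF inv] by blast
    have "\<not> t < length p"
      using t_in_S[OF inv] stop \<open>S = {}\<close> by blast
    then have "t = length p"
      using inv by (simp add: scan_inv_def)
    then show "\<forall>i<length p. snd s i = Some (scan 0 0 p ! i)"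
      using scan_inv_end inv by (simp add: s)
  qed simp
  then have "\<forall>i<length p. labelling p i = Some (scan 0 0 p ! i)"
    unfolding labelling_def .
  then show ?thesis
    by (intro nth_equalityI) (auto simp: phi_def)
qed


section \<open>The bijection\<close>

theorem mainTheorem1:
  fixes n :: nat
  assumes "n \<ge> 1"
  shows "bij_betw phi (motzkin_paths n) (yamanouchi_words_3 n)"
proof -
  have "bij_betw phi (motzkin_paths n) (yamanouchi_words_3 n) \<longleftrightarrow>
      bij_betw (scan 0 0) (motzkin_paths n) (yamanouchi_words_3 n)"
    by (intro bij_betw_cong phi_eq_scan) (simp add: motzkin_paths_iff_descends)
  then show ?thesis
    using bij_betw_scan by blast
qed

end
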